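(* Let $R(x,y)=\sum_{n,k\ge1}r_{n,k}x^ny^k$, where $r_{n,k}$ is the number of Schroeder trees with $n$ leaves and exactly $k$ vertices in total (leaves included). Then $$R(x,y)=\frac{1+xy-\sqrt{(xy)^2+2xy+1-4xy(y+1)}}{2y+2}.$$
   Context: A Schroeder tree is a finite rooted plane tree (the children of each vertex are linearly ordered) in which every non-leaf vertex has at least two children. A leaf is a vertex with no children; the one-vertex tree is a Schroeder tree with one leaf. Trees are counted up to isomorphism of rooted plane trees. The square root denotes the formal power series square root in $\mathbb{Q}[[x,y]]$ with constant term $1$. *)

theory Defs
  imports "HOL-Computational_Algebra.Formal_Power_Series"
begin

unbundle fps_syntax

text \<open>
  A plane tree is given by the list of the subtrees at the children of its root. Each
  isomorphism class of finite rooted plane trees has exactly one representative of this type,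
  so counting values of the type is counting plane trees up to isomorphism.
\<close>

datatype plane_tree = Node (children: "plane_tree list")

fun leaves :: "plane_tree \<Rightarrow> nat" where
  "leaves (Node ts) = (if ts = [] then 1 else (\<Sum>t\<leftarrow>ts. leaves t))"

fun vertices :: "plane_tree \<Rightarrow> nat" where
  "vertices (Node ts) = 1 + (\<Sum>t\<leftarrow>ts. vertices t)"

fun schroeder :: "plane_tree \<Rightarrow> bool" where
  "schroeder (Node ts) \<longleftrightarrow> (ts \<noteq> [] \<longrightarrow> 2 \<le> length ts) \<and> (\<forall>t\<in>set ts. schroeder t)"

definition schroeder_trees :: "nat \<Rightarrow> nat \<Rightarrow> plane_tree set" where
  "schroeder_trees n k = {t. schroeder t \<and> leaves t = n \<and> vertices t = k}"

definition schroeder_count :: "nat \<Rightarrow> nat \<Rightarrow> nat" where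
  "schroeder_count n k = card (schroeder_trees n k)"

lemma vertices_pos: "0 < vertices t"
  by (cases t) simp

lemma finite_vertices_le: "finite {t. vertices t \<le> k}"
proof (induction k)
  case 0
  have "{t. vertices t \<le> 0} = {}"
  proof (intro equals0I)
    fix t assume "t \<in> {t. vertices t \<le> 0}"
    then show False using vertices_pos[of t] by simp
  qed
  then show ?case by (simp only: finite.emptyI)
next
  case (Suc k)
  have "{t. vertices t \<le> Suc k} \<subseteq> Node ` {ts. set ts \<subseteq> {t. vertices t \<le> k} \<and> length ts \<le> k}"
  proof
    fix t assume t: "t \<in> {t. vertices t \<le> Suc k}"
    obtain ts where ts: "t = Node ts" by (cases t)
    have le: "(\<Sum>t\<leftarrow>ts. vertices t) \<le> k" using t ts by simp
    have "length ts \<le> (\<Sum>t\<leftarrow>ts. vertices t)"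
    proof (induction ts)
      case (Cons u us)
      then show ?case using vertices_pos[of u] by simp
    qed simp
    then have "length ts \<le> k" using le by (rule le_trans)
    moreover have "vertices u \<le> k" if "u \<in> set ts" for u
    proof -
      have "vertices u \<le> (\<Sum>t\<leftarrow>ts. vertices t)"
        using that by (intro member_le_sum_list) auto
      then show ?thesis using le by (rule le_trans)
    qed
    ultimately show "t \<in> Node ` {ts. set ts \<subseteq> {t. vertices t \<le> k} \<and> length ts \<le> k}"
      unfolding ts by (intro imageI) auto
  qed
  then show ?case
    by (rule finite_surj[OF finite_lists_length_le[OF Suc.IH]])
qed

lemma finite_schroeder_trees: "finite (schroeder_trees n k)"
  by (rule finite_subset[OF _ finite_vertices_le[of k]]) (auto simp: schroeder_trees_def)

text \<open>
  The ring of formal power series in \<open>x\<close> and \<open>y\<close> over the rationals is rendered as the iterated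
  power series ring in \<open>x\<close> over power series in \<open>y\<close>: the coefficient of \<open>x\<^sup>n y\<^sup>k\<close> in \<open>F\<close>
  is \<open>F $ n $ k\<close>.
\<close>

type_synonym fps2 = "rat fps fps"

definition var_x :: fps2 where "var_x = fps_X"

definition var_y :: fps2 where "var_y = fps_const fps_X"

text \<open>
  The library's \<open>fps_radical\<close> requires coefficients in a field, so it does not apply here.
  The choice below is meaningful if the constant term of \<open>F\<close> is 1; uniqueness is shown next.
\<close>

definition fps2_sqrt :: "fps2 \<Rightarrow> fps2" where
  "fps2_sqrt F = (THE S. S ^ 2 = F \<and> S $ 0 $ 0 = 1)"

lemma fps2_sqrt_unique:
  fixes S T :: fps2
  assumes "S ^ 2 = T ^ 2" "S $ 0 $ 0 = 1" "T $ 0 $ 0 = 1"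
  shows "S = T"
proof -
  have "S = T \<or> S = - T" using assms(1) by (simp add: power2_eq_iff)
  moreover have "S \<noteq> - T" using assms(2,3) by auto
  ultimately show ?thesis by blast
qed

lemma fps2_sqrt_eqI: "S ^ 2 = F \<Longrightarrow> S $ 0 $ 0 = 1 \<Longrightarrow> fps2_sqrt F = S"
  unfolding fps2_sqrt_def by (rule the_equality) (auto intro: fps2_sqrt_unique)

text \<open>
  The library's \<open>/\<close> on iterated power series is division in the ring whenever the
  denominator has nonzero constant term.
\<close>

lemma fps2_divide_eq_iff:
  fixes F G H :: fps2
  assumes "G $ 0 $ 0 \<noteq> 0"
  shows "F / G = H \<longleftrightarrow> F = H * G"
proof -
  have inv: "G $ 0 * inverse (G $ 0) = 1"
    using inverse_mult_eq_1[OF assms] by (simp only: mult.commute)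
  have G: "G * inverse G = 1"
    unfolding fps_inverse_def[of G] by (rule fps_right_inverse[OF inv])
  have "G $ 0 \<noteq> 0" using assms by auto
  then have div: "F / G = F * inverse G" by (rule fps_divide_unit)
  show ?thesis
  proof
    assume "F / G = H"
    then have "H * G = F * inverse G * G" by (simp only: div)
    also have "\<dots> = F * (G * inverse G)" by (simp only: mult_ac)
    finally show "F = H * G" by (simp only: G mult_1_right)
  next
    assume F: "F = H * G"
    have "F / G = H * G * inverse G" unfolding div unfolding F by (rule refl)
    also have "\<dots> = H * (G * inverse G)" by (simp only: mult_ac)
    finally show "F / G = H" by (simp only: G mult_1_right)
  qed
qed

definition schroeder_gf :: fps2 where
  "schroeder_gf = Abs_fps (\<lambda>n. Abs_fps (\<lambda>k. if 1 \<le> n \<and> 1 \<le> k then of_nat (schroeder_count n k) else 0))"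

end

theory Submission
  imports Defs
begin

text \<open>
  Besides the series \<open>R\<close> of Schroeder trees, consider the series \<open>Q\<close> of finite lists of such
  trees, a list being weighted by its total numbers of leaves and vertices. Splitting off the
  head of a list gives \<open>Q = 1 + R Q\<close>. A Schroeder tree is a single leaf or a root above a list
  of length at least two, so \<open>R = x y + y (Q - 1 - R)\<close>. Eliminating \<open>Q\<close> yields
  \<open>(1 + y) R\<^sup>2 - (1 + x y) R + x y = 0\<close>; completing the square, \<open>1 + x y - 2 (1 + y) R\<close> is a
  square root of the discriminant, and its constant term is 1.
\<close>

text \<open>Since \<open>card\<close> is 0 on infinite sets, the coefficients are true counts only
  if the joint fibres of \<open>l\<close> and \<open>v\<close> are finite. Finite fibres of
  \<open>v\<close> alone suffice for this, and numbers of vertices provide them.\<close>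

definition weight_gf :: "'a set \<Rightarrow> ('a \<Rightarrow> nat) \<Rightarrow> ('a \<Rightarrow> nat) \<Rightarrow> fps2" where
  "weight_gf A l v = Abs_fps (\<lambda>n. Abs_fps (\<lambda>k. of_nat (card {a \<in> A. l a = n \<and> v a = k})))"

lemma weight_gf_nth: "weight_gf A l v $ n $ k = of_nat (card {a \<in> A. l a = n \<and> v a = k})"
  by (simp add: weight_gf_def)

lemma fps2_eqI: "(\<And>n k. F $ n $ k = G $ n $ k) \<Longrightarrow> F = (G :: fps2)"
  by (simp add: fps_eq_iff)

lemma weight_gf_cong:
  "(\<And>a. a \<in> A \<Longrightarrow> l a = l' a) \<Longrightarrow> (\<And>a. a \<in> A \<Longrightarrow> v a = v' a) \<Longrightarrow> weight_gf A l v = weight_gf A l' v'"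
  by (rule fps2_eqI) (auto simp: weight_gf_nth intro!: arg_cong[where f = card])

lemma weight_gf_Un:
  assumes "A \<inter> B = {}" "\<And>k. finite {a \<in> A. v a = k}" "\<And>k. finite {b \<in> B. v b = k}"
  shows "weight_gf (A \<union> B) l v = weight_gf A l v + weight_gf B l v"
proof (rule fps2_eqI)
  fix n k :: nat
  let ?fib = "\<lambda>C. {a \<in> C. l a = n \<and> v a = k}"
  have "finite (?fib A)" "finite (?fib B)"
    by (rule finite_subset[OF _ assms(2)[of k]], blast)
      (rule finite_subset[OF _ assms(3)[of k]], blast)
  moreover have "?fib (A \<union> B) = ?fib A \<union> ?fib B" "?fib A \<inter> ?fib B = {}"
    using assms(1) by auto
  ultimately have "card (?fib (A \<union> B)) = card (?fib A) + card (?fib B)"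
    by (simp add: card_Un_disjoint)
  then show "weight_gf (A \<union> B) l v $ n $ k = (weight_gf A l v + weight_gf B l v) $ n $ k"
    by (simp add: weight_gf_nth)
qed

lemma weight_gf_image:
  assumes "inj_on f A"
  shows "weight_gf (f ` A) l v = weight_gf A (\<lambda>a. l (f a)) (\<lambda>a. v (f a))"
proof (rule fps2_eqI)
  fix n k :: nat
  have "{b \<in> f ` A. l b = n \<and> v b = k} = f ` {a \<in> A. l (f a) = n \<and> v (f a) = k}" by auto
  moreover have "inj_on f {a \<in> A. l (f a) = n \<and> v (f a) = k}"
    using assms by (rule inj_on_subset) auto
  ultimately show "weight_gf (f ` A) l v $ n $ k
      = weight_gf A (\<lambda>a. l (f a)) (\<lambda>a. v (f a)) $ n $ k"
    by (simp add: weight_gf_nth card_image)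
qed

text \<open>Multiplication by \<open>var_y\<close> shifts the inner index by one. At
  \<open>k = 0\<close> both sides vanish, as no \<open>Suc (v a)\<close> is 0.\<close>

lemma weight_gf_Suc: "weight_gf A l (\<lambda>a. Suc (v a)) = var_y * weight_gf A l v"
proof (rule fps2_eqI)
  fix n k :: nat
  show "weight_gf A l (\<lambda>a. Suc (v a)) $ n $ k = (var_y * weight_gf A l v) $ n $ k"
    by (cases k) (simp_all add: weight_gf_nth var_y_def)
qed

lemma weight_gf_singleton: "weight_gf {a} l v = var_x ^ l a * var_y ^ v a"
proof (rule fps2_eqI)
  fix n k :: nat
  have "{b \<in> {a}. l b = n \<and> v b = k} = (if l a = n \<and> v a = k then {a} else {})" by auto
  then show "weight_gf {a} l v $ n $ k = (var_x ^ l a * var_y ^ v a) $ n $ k"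
    by (auto simp: weight_gf_nth var_x_def var_y_def fps_const_power fps_X_power_mult_nth fps_X_power_nth)
qed

text \<open>Sorting the pairs by the weights \<open>(i, j)\<close> of their first component turns
  the count into the Cauchy product, taken in both indices at once.\<close>

lemma weight_gf_Times:
  assumes "\<And>k. finite {a \<in> A. v a = k}" "\<And>k. finite {b \<in> B. w b = k}"
  shows "weight_gf (A \<times> B) (\<lambda>(a, b). l a + m b) (\<lambda>(a, b). v a + w b)
           = weight_gf A l v * weight_gf B m w"
proof (rule fps2_eqI)
  fix n k :: nat
  define P where "P i j = {a \<in> A. l a = i \<and> v a = j}" for i j
  define Q where "Q i j = {b \<in> B. m b = i \<and> w b = j}" for i j
  have fin: "finite (P i j)" "finite (Q i j)" for i j
    unfolding P_def Q_def
    by (rule finite_subset[OF _ assms(1)[of j]], blast)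
      (rule finite_subset[OF _ assms(2)[of j]], blast)
  let ?I = "{0..n} \<times> {0..k}"
  let ?C = "\<lambda>(i, j). P i j \<times> Q (n - i) (k - j)"
  have "{c \<in> A \<times> B. (case c of (a, b) \<Rightarrow> l a + m b) = n \<and> (case c of (a, b) \<Rightarrow> v a + w b) = k}
      = (\<Union>(i, j)\<in>?I. P i j \<times> Q (n - i) (k - j))"
    by (auto simp: P_def Q_def)
  \<comment> \<open>The blocks are disjoint because the first component \<open>a\<close> determines
    \<open>i = l a\<close> and \<open>j = v a\<close>.\<close>
  moreover have "card (\<Union>p\<in>?I. ?C p) = (\<Sum>p\<in>?I. card (?C p))"
    by (rule card_UN_disjoint) (auto simp: fin, auto simp: P_def)
  ultimately have "card {c \<in> A \<times> B. (case c of (a, b) \<Rightarrow> l a + m b) = n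
      \<and> (case c of (a, b) \<Rightarrow> v a + w b) = k}
      = (\<Sum>i=0..n. \<Sum>j=0..k. card (P i j) * card (Q (n - i) (k - j)))"
    by (simp add: sum.cartesian_product card_cartesian_product case_prod_unfold)
  then show "weight_gf (A \<times> B) (\<lambda>(a, b). l a + m b) (\<lambda>(a, b). v a + w b) $ n $ k
      = (weight_gf A l v * weight_gf B m w) $ n $ k"
    by (simp add: weight_gf_nth fps_mult_nth fps_sum_nth P_def Q_def)
qed

abbreviation "list_leaves ts \<equiv> (\<Sum>t\<leftarrow>ts. leaves t)"
abbreviation "list_vertices ts \<equiv> (\<Sum>t\<leftarrow>ts. vertices t)"

lemma finite_vertices_eq: "finite {t \<in> A. vertices t = k}"
  by (rule finite_subset[OF _ finite_vertices_le[of k]]) auto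

text \<open>Placing a root above a list is injective and adds one vertex, so finiteness carries over
  from trees with at most \<open>Suc k\<close> vertices.\<close>

lemma finite_list_vertices_eq: "finite {ts \<in> L. list_vertices ts = k}"
proof (rule finite_imageD)
  show "finite (Node ` {ts \<in> L. list_vertices ts = k})"
    by (rule finite_subset[OF _ finite_vertices_le[of "Suc k"]]) auto
qed (simp add: inj_on_def)

lemma leaves_pos: "0 < leaves t"
proof (induction t)
  case (Node ts)
  then show ?case by (cases ts) auto
qed

text \<open>The cut-off at \<open>n = 0\<close> or \<open>k = 0\<close> in
  \<open>schroeder_gf\<close> loses nothing: every tree has a leaf and a vertex.\<close>

lemma schroeder_gf_eq_weight_gf: "schroeder_gf = weight_gf (Collect schroeder) leaves vertices"
proof (rule fps2_eqI)
  fix n k :: nat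
  have "{t. schroeder t \<and> leaves t = n \<and> vertices t = k} = {}" if "n = 0 \<or> k = 0"
    using that by (auto simp: leaves_pos[THEN gr_implies_not0] vertices_pos[THEN gr_implies_not0])
  then show "schroeder_gf $ n $ k = weight_gf (Collect schroeder) leaves vertices $ n $ k"
    by (auto simp: schroeder_gf_def weight_gf_nth schroeder_count_def schroeder_trees_def
        Suc_le_eq simp del: Collect_empty_eq)
qed

text \<open>This is the series \<open>Q\<close> from above; the empty list supplies its constant
  term 1.\<close>

definition schroeder_list_gf :: fps2 where
  "schroeder_list_gf = weight_gf (lists (Collect schroeder)) list_leaves list_vertices"

lemma schroeder_list_gf_Cons: "schroeder_list_gf = 1 + schroeder_gf * schroeder_list_gf"
proof -
  let ?S = "Collect schroeder"
  let ?C = "(\<lambda>(t, ts). t # ts) ` (?S \<times> lists ?S)"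
  have "lists ?S = {[]} \<union> ?C"
  proof (intro equalityI subsetI)
    fix ts assume "ts \<in> lists ?S"
    then show "ts \<in> {[]} \<union> ?C" by (cases ts) auto
  qed auto
  then have "schroeder_list_gf = weight_gf ({[]} \<union> ?C) list_leaves list_vertices"
    by (simp add: schroeder_list_gf_def)
  also have "\<dots> = weight_gf {[]} list_leaves list_vertices + weight_gf ?C list_leaves list_vertices"
    by (rule weight_gf_Un[OF _ finite_list_vertices_eq finite_list_vertices_eq]) auto
  also have "weight_gf {[]} list_leaves list_vertices = 1"
    by (simp add: weight_gf_singleton)
  also have "weight_gf ?C list_leaves list_vertices
      = weight_gf (?S \<times> lists ?S) (\<lambda>(t, ts). leaves t + list_leaves ts)
          (\<lambda>(t, ts). vertices t + list_vertices ts)"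
    by (subst weight_gf_image) (auto simp: inj_on_def intro!: weight_gf_cong)
  also have "\<dots> = schroeder_gf * schroeder_list_gf"
    unfolding schroeder_gf_eq_weight_gf schroeder_list_gf_def
    by (rule weight_gf_Times[OF finite_vertices_eq finite_list_vertices_eq])
  finally show ?thesis .
qed

lemma schroeder_gf_Node:
  "schroeder_gf = var_x * var_y + var_y * (schroeder_list_gf - 1 - schroeder_gf)"
proof -
  let ?S = "Collect schroeder"
  let ?M = "{ts \<in> lists ?S. 2 \<le> length ts}"
  have "lists ?S = ({[]} \<union> (\<lambda>t. [t]) ` ?S) \<union> ?M"
  proof (intro equalityI subsetI)
    fix ts assume ts: "ts \<in> lists ?S"
    \<comment> \<open>The rule \<open>remdups_adj.cases\<close> serves only for its split into lists
      of length 0, 1 and at least 2.\<close>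
    then consider "ts = []" | t where "ts = [t]" "t \<in> ?S" | "2 \<le> length ts"
      by (cases ts rule: remdups_adj.cases) auto
    then show "ts \<in> ({[]} \<union> (\<lambda>t. [t]) ` ?S) \<union> ?M" using ts by cases auto
  qed auto
  then have "schroeder_list_gf
      = weight_gf (({[]} \<union> (\<lambda>t. [t]) ` ?S) \<union> ?M) list_leaves list_vertices"
    by (simp add: schroeder_list_gf_def)
  also have "\<dots> = weight_gf ({[]} \<union> (\<lambda>t. [t]) ` ?S) list_leaves list_vertices
      + weight_gf ?M list_leaves list_vertices"
    by (rule weight_gf_Un[OF _ finite_list_vertices_eq finite_list_vertices_eq]) auto
  also have "weight_gf ({[]} \<union> (\<lambda>t. [t]) ` ?S) list_leaves list_vertices
      = weight_gf {[]} list_leaves list_vertices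
        + weight_gf ((\<lambda>t. [t]) ` ?S) list_leaves list_vertices"
    by (rule weight_gf_Un[OF _ finite_list_vertices_eq finite_list_vertices_eq]) auto
  also have "weight_gf {[]} list_leaves list_vertices = 1"
    by (simp add: weight_gf_singleton)
  also have "weight_gf ((\<lambda>t. [t]) ` ?S) list_leaves list_vertices = schroeder_gf"
    by (simp add: weight_gf_image inj_on_def schroeder_gf_eq_weight_gf)
  finally have M: "weight_gf ?M list_leaves list_vertices = schroeder_list_gf - 1 - schroeder_gf"
    by (metis add_diff_cancel_left' diff_diff_eq)
  \<comment> \<open>The leaf is kept apart because \<open>leaves (Node [])\<close> is 1 while
    \<open>list_leaves []\<close> is 0. On \<open>Node ts\<close> with \<open>ts\<close> in
    \<open>?M\<close> the two counts agree, and the root accounts for the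
    \<open>Suc\<close>.\<close>
  have "?S = {Node []} \<union> Node ` ?M"
  proof (intro equalityI subsetI)
    fix t assume "t \<in> ?S"
    then show "t \<in> {Node []} \<union> Node ` ?M" by (cases t) (auto simp: image_iff)
  qed auto
  then have "schroeder_gf = weight_gf ({Node []} \<union> Node ` ?M) leaves vertices"
    by (simp add: schroeder_gf_eq_weight_gf)
  also have "\<dots> = weight_gf {Node []} leaves vertices + weight_gf (Node ` ?M) leaves vertices"
    by (rule weight_gf_Un[OF _ finite_vertices_eq finite_vertices_eq]) auto
  also have "weight_gf {Node []} leaves vertices = var_x * var_y"
    by (simp add: weight_gf_singleton)
  also have "weight_gf (Node ` ?M) leaves vertices
      = weight_gf ?M list_leaves (\<lambda>ts. Suc (list_vertices ts))"
    by (subst weight_gf_image) (auto simp: inj_on_def intro!: weight_gf_cong)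
  also have "\<dots> = var_y * (schroeder_list_gf - 1 - schroeder_gf)"
    by (simp only: weight_gf_Suc M)
  finally show ?thesis .
qed

lemma schroeder_gf_quadratic:
  "(1 + var_y) * schroeder_gf ^ 2 + var_x * var_y = (1 + var_x * var_y) * schroeder_gf"
  using schroeder_list_gf_Cons schroeder_gf_Node by algebra

theorem lemma3p2:
  shows "schroeder_gf
           = (1 + var_x * var_y
              - fps2_sqrt ((var_x * var_y) ^ 2 + 2 * var_x * var_y + 1 - 4 * var_x * var_y * (var_y + 1)))
             / (2 * var_y + 2)"
proof -
  let ?S = "1 + var_x * var_y - (2 * var_y + 2) * schroeder_gf"
  \<comment> \<open>The two sides differ by \<open>4 * (1 + var_y)\<close> times the quadratic
    relation.\<close>
  have "?S ^ 2 = (var_x * var_y) ^ 2 + 2 * var_x * var_y + 1 - 4 * var_x * var_y * (var_y + 1)"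
    using schroeder_gf_quadratic by algebra
  \<comment> \<open>Neither \<open>var_x\<close> nor \<open>schroeder_gf\<close> has a constant
    term. This singles out \<open>?S\<close> against \<open>- ?S\<close>.\<close>
  moreover have "?S $ 0 $ 0 = 1"
    by (simp add: var_x_def schroeder_gf_def)
  ultimately have "fps2_sqrt ((var_x * var_y) ^ 2 + 2 * var_x * var_y + 1
      - 4 * var_x * var_y * (var_y + 1)) = ?S"
    by (rule fps2_sqrt_eqI)
  \<comment> \<open>The constant term is 2, so the quotient is a genuine division and the formula
    can be solved for \<open>schroeder_gf\<close>.\<close>
  moreover have "(2 * var_y + 2) $ 0 $ 0 \<noteq> 0"
    by (simp add: var_y_def fps_numeral_nth)
  ultimately show ?thesis
    by (simp add: fps2_divide_eq_iff eq_commute[of schroeder_gf] mult.commute)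
qed

end
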